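(* Every finite MR-algebra is isomorphic (as an ordered set) to the poset of nonempty faces of an $n$-cube, ordered by inclusion, for some $n\ge 0$.
   Context: A cubic algebra is a join-semilattice with greatest element $1$ and an operation $\Delta$ (only the values $\Delta(y,x)$ with $x\le y$ matter) such that: (1) $x\le y$ implies $\Delta(y,x)\vee x=y$; (2) $x\le y\le z$ implies $\Delta(z,\Delta(y,x))=\Delta(\Delta(z,y),\Delta(z,x))$; (3) $x\le y$ implies $\Delta(y,\Delta(y,x))=x$; (4) $x\le y\le z$ implies $\Delta(z,x)\le\Delta(z,y)$; and, writing $xy=\Delta(1,\Delta(x\vee y,y))\vee y$, (5) $(xy)y=x\vee y$; (6) $x(yz)=y(xz)$. An MR-algebra is a cubic algebra satisfying the MR-axiom: for all $a,b<x$, $\Delta(x,a)\vee b<x$ if and only if the meet (greatest lower bound) $a\wedge b$ does not exist. The $n$-cube itself counts as a face. *)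

theory Defs
  imports "HOL-Analysis.Analysis" "HOL-Library.Function_Algebras" "HOL-Library.Lub_Glb"
begin

text \<open>
  Cubic algebras live on a type that is a join-semilattice with greatest element.
  The operation is a total function, but the axioms only constrain the values
  \<open>\<Delta> y x\<close> with \<open>x \<le> y\<close>.
\<close>

definition cubic_imp :: "('a \<Rightarrow> 'a \<Rightarrow> 'a) \<Rightarrow> 'a \<Rightarrow> 'a \<Rightarrow> 'a::{semilattice_sup, order_top}"
  where "cubic_imp \<Delta> x y = sup (\<Delta> top (\<Delta> (sup x y) y)) y"

locale cubic_algebra =
  fixes \<Delta> :: "'a::{semilattice_sup, order_top} \<Rightarrow> 'a \<Rightarrow> 'a"
  assumes sup_Delta: "x \<le> y \<Longrightarrow> sup (\<Delta> y x) x = y"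
    and Delta_Delta: "x \<le> y \<Longrightarrow> y \<le> z \<Longrightarrow> \<Delta> z (\<Delta> y x) = \<Delta> (\<Delta> z y) (\<Delta> z x)"
    and Delta_invol: "x \<le> y \<Longrightarrow> \<Delta> y (\<Delta> y x) = x"
    and Delta_mono: "x \<le> y \<Longrightarrow> y \<le> z \<Longrightarrow> \<Delta> z x \<le> \<Delta> z y"
    and imp_imp: "cubic_imp \<Delta> (cubic_imp \<Delta> x y) y = sup x y"
    and imp_left_commute:
      "cubic_imp \<Delta> x (cubic_imp \<Delta> y z) = cubic_imp \<Delta> y (cubic_imp \<Delta> x z)"

locale MR_algebra = cubic_algebra \<Delta>
  for \<Delta> :: "'a::{semilattice_sup, order_top} \<Rightarrow> 'a \<Rightarrow> 'a" +
  assumes MR: "a < x \<Longrightarrow> b < x \<Longrightarrow>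
    sup (\<Delta> x a) b < x \<longleftrightarrow> \<not> (\<exists>m. isGlb UNIV {a, b} m)"

text \<open>
  The dimension of the cube is quantified inside the statement, so all cubes are
  placed in one real vector space, the space of real sequences (with pointwise
  operations), where \<open>\<real>\<^sup>n\<close> is the subspace of sequences vanishing from index \<open>n\<close> on.
\<close>

instantiation "fun" :: (type, real_vector) real_vector
begin

definition scaleR_fun :: "real \<Rightarrow> ('a \<Rightarrow> 'b) \<Rightarrow> 'a \<Rightarrow> 'b"
  where "scaleR_fun c f = (\<lambda>x. c *\<^sub>R f x)"

instance
  by standard (auto simp: scaleR_fun_def fun_eq_iff scaleR_add_right scaleR_add_left)

end

definition unit_cube :: "nat \<Rightarrow> (nat \<Rightarrow> real) set"
  where "unit_cube n = {p. (\<forall>i<n. 0 \<le> p i \<and> p i \<le> 1) \<and> (\<forall>i\<ge>n. p i = 0)}"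

text \<open>
  The library's faces of a convex set include the set itself and the empty set.
\<close>

definition nonempty_faces :: "'a::real_vector set \<Rightarrow> 'a set set"
  where "nonempty_faces S = {F. F face_of S \<and> F \<noteq> {}}"

end

theory Submission
  imports Defs
begin

text \<open>
  In a finite MR-algebra every principal filter is Boolean, so an element is determined by the
  coatoms above it. The map \<open>\<Delta> top\<close> pairs off the coatoms without fixed points, and the MR-axiom
  at \<open>top\<close> says that a set of coatoms is the set of all coatoms above some element if and only if it
  contains no such pair. On the other side, a nonempty face of the cube is determined by the facets
  containing it, and these can be any set of facets without two opposite ones.
\<close>

section \<open>Faces of the unit cube\<close>

text \<open>The index sets stand for the facets containing a face: \<open>A\<close> for the facets
  \<open>p i = 0\<close>, \<open>B\<close> for the facets \<open>p i = 1\<close>. Larger index sets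
  give smaller faces.\<close>

definition subcube :: "nat \<Rightarrow> nat set \<Rightarrow> nat set \<Rightarrow> (nat \<Rightarrow> real) set"
  where "subcube n A B = {p \<in> unit_cube n. (\<forall>i\<in>A. p i = 0) \<and> (\<forall>i\<in>B. p i = 1)}"

lemma convex_comb_eq_0_iff:
  fixes a b u :: real
  assumes "0 \<le> a" "0 \<le> b" "0 < u" "u < 1"
  shows "(1 - u) * a + u * b = 0 \<longleftrightarrow> a = 0 \<and> b = 0"
  using assms by (subst add_nonneg_eq_0_iff) auto

lemma convex_comb_eq_1_iff:
  fixes a b u :: real
  assumes "a \<le> 1" "b \<le> 1" "0 < u" "u < 1"
  shows "(1 - u) * a + u * b = 1 \<longleftrightarrow> a = 1 \<and> b = 1"
proof -
  have "(1 - u) * a + u * b = 1 \<longleftrightarrow> (1 - u) * (1 - a) + u * (1 - b) = 0"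
    by (auto simp: algebra_simps)
  also have "\<dots> \<longleftrightarrow> a = 1 \<and> b = 1"
    using assms convex_comb_eq_0_iff[of "1 - a" "1 - b" u] by auto
  finally show ?thesis .
qed

lemma convex_unit_cube: "convex (unit_cube n)"
  unfolding convex_alt unit_cube_def
  by (simp add: scaleR_fun_def convex_bound_le)

text \<open>The values 0 and 1 are the end points of the unit interval, so a proper convex
  combination takes one of them at a coordinate only if both of its ends do.\<close>

lemma subcube_face_of: "subcube n A B face_of unit_cube n"
  unfolding face_of_def
proof (intro conjI ballI impI)
  show "subcube n A B \<subseteq> unit_cube n"
    by (auto simp: subcube_def)
  show "convex (subcube n A B)"
    using convex_unit_cube[of n] unfolding convex_alt
    by (auto simp: subcube_def scaleR_fun_def)
next
  fix a b x
  assume ab: "a \<in> unit_cube n" "b \<in> unit_cube n" and x: "x \<in> subcube n A B"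
    and seg: "x \<in> open_segment a b"
  obtain u where u: "0 < u" "u < 1" and xu: "x = (1 - u) *\<^sub>R a + u *\<^sub>R b"
    using seg by (auto simp: in_segment)
  have bounds: "0 \<le> a i" "a i \<le> 1" "0 \<le> b i" "b i \<le> 1" for i
    using ab by (cases "i < n"; auto simp: unit_cube_def)+
  have xi: "x i = (1 - u) * a i + u * b i" for i
    by (simp add: xu scaleR_fun_def)
  have "a i = 0 \<and> b i = 0" if "i \<in> A" for i
  proof -
    have "(1 - u) * a i + u * b i = 0"
      using x that unfolding subcube_def xi[symmetric] by blast
    then show ?thesis
      using convex_comb_eq_0_iff[OF bounds(1,3) u] by blast
  qed
  moreover have "a i = 1 \<and> b i = 1" if "i \<in> B" for i
  proof -
    have "(1 - u) * a i + u * b i = 1"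
      using x that unfolding subcube_def xi[symmetric] by blast
    then show ?thesis
      using convex_comb_eq_1_iff[OF bounds(2,4) u] by blast
  qed
  ultimately show "a \<in> subcube n A B" "b \<in> subcube n A B"
    using ab by (auto simp: subcube_def)
qed

text \<open>For disjoint \<open>A\<close> and \<open>B\<close> below \<open>n\<close> this is the
  barycentre of the subcube. It takes the values 0 and 1 only where they are forced, so it reveals
  \<open>A\<close> and \<open>B\<close>.\<close>

definition center :: "nat \<Rightarrow> nat set \<Rightarrow> nat set \<Rightarrow> nat \<Rightarrow> real"
  where "center n A B i = (if i \<in> A \<or> i \<ge> n then 0 else if i \<in> B then 1 else 1/2)"

lemma center_in_subcube:
  assumes "B \<subseteq> {..<n}" "A \<inter> B = {}"
  shows "center n A B \<in> subcube n A B"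
  using assms by (auto simp: subcube_def unit_cube_def center_def)

text \<open>The center of the smaller subcube lies in the larger one, which can therefore fix only
  those coordinates that the smaller one fixes.\<close>

lemma subcube_subset_iff:
  assumes "A \<subseteq> {..<n}" "B \<subseteq> {..<n}" "A \<inter> B = {}" "A' \<subseteq> {..<n}" "B' \<subseteq> {..<n}"
  shows "subcube n A B \<subseteq> subcube n A' B' \<longleftrightarrow> A' \<subseteq> A \<and> B' \<subseteq> B"
proof
  assume "subcube n A B \<subseteq> subcube n A' B'"
  then have *: "center n A B \<in> subcube n A' B'"
    using center_in_subcube assms by blast
  have "i \<in> A" if "i \<in> A'" for i
  proof -
    \<comment> \<open>The bound \<open>i < n\<close> matters, because the center also vanishes from
      index \<open>n\<close> on.\<close>
    have "center n A B i = 0" "i < n"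
      using * that assms by (auto simp: subcube_def)
    then show ?thesis by (auto simp: center_def split: if_splits)
  qed
  moreover have "i \<in> B" if "i \<in> B'" for i
  proof -
    have "center n A B i = 1"
      using * that by (auto simp: subcube_def)
    then show ?thesis by (auto simp: center_def split: if_splits)
  qed
  ultimately show "A' \<subseteq> A \<and> B' \<subseteq> B" by blast
qed (auto simp: subcube_def)

text \<open>Let \<open>A\<close> and \<open>B\<close> collect the coordinates that are constantly 0
  or constantly 1 on \<open>F\<close>. Convexity yields a point of \<open>F\<close> with all other
  coordinates strictly between 0 and 1, and the face property then forces the whole subcube into
  \<open>F\<close>.\<close>

lemma face_of_unit_cube_eq_subcube:
  assumes F: "F face_of unit_cube n" and "F \<noteq> {}"
  obtains A B where "A \<subseteq> {..<n}" "B \<subseteq> {..<n}" "A \<inter> B = {}" "F = subcube n A B"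
proof -
  define A where "A = {i. i < n \<and> (\<forall>p\<in>F. p i = 0)}"
  define B where "B = {i. i < n \<and> (\<forall>p\<in>F. p i = 1)}"
  have FC: "F \<subseteq> unit_cube n" and cF: "convex F"
    using F by (auto simp: face_of_def)
  have bounds: "0 \<le> p i" "p i \<le> 1" if "p \<in> unit_cube n" for p i
    using that by (cases "i < n"; auto simp: unit_cube_def)+
  have "\<exists>p\<in>F. \<forall>i<k. i < n \<longrightarrow> i \<notin> A \<longrightarrow> i \<notin> B \<longrightarrow> 0 < p i \<and> p i < 1" for k
  proof (induction k)
    case 0
    then show ?case using \<open>F \<noteq> {}\<close> by auto
  next
    case (Suc k)
    then obtain p where p: "p \<in> F"
      "\<And>i. i < k \<Longrightarrow> i < n \<Longrightarrow> i \<notin> A \<Longrightarrow> i \<notin> B \<Longrightarrow> 0 < p i \<and> p i < 1" by blast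
    show ?case
    proof (cases "k < n \<and> k \<notin> A \<and> k \<notin> B")
      case False
      then show ?thesis using p by (metis less_SucE)
    next
      case True
      then obtain q r where qr: "q \<in> F" "q k \<noteq> 0" "r \<in> F" "r k \<noteq> 1"
        by (auto simp: A_def B_def)
      \<comment> \<open>The midpoint of \<open>q\<close> and \<open>r\<close> is strictly between 0
        and 1 at \<open>k\<close>. Averaging it with \<open>p\<close> keeps this and also preserves
        the strict bounds that \<open>p\<close> satisfies at earlier coordinates.\<close>
      define m where "m = (1 - 1/2) *\<^sub>R q + (1/2::real) *\<^sub>R r"
      define s where "s = (1 - 1/2) *\<^sub>R p + (1/2::real) *\<^sub>R m"
      have mF: "m \<in> F" unfolding m_def
        using cF qr(1,3) unfolding convex_alt by (elim ballE allE[of _ "1/2"]) auto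
      have sF: "s \<in> F" unfolding s_def
        using cF p(1) mF unfolding convex_alt by (elim ballE allE[of _ "1/2"]) auto
      have si: "s i = (p i + m i) / 2" and mi: "m i = (q i + r i) / 2" for i
        by (simp_all add: s_def m_def scaleR_fun_def)
      have bm: "0 \<le> m i" "m i \<le> 1" and bp: "0 \<le> p i" "p i \<le> 1" for i
        using bounds FC mF p(1) by blast+
      have "0 \<le> q k" "q k \<le> 1" "0 \<le> r k" "r k \<le> 1"
        using bounds FC qr by blast+
      then have "0 < m k \<and> m k < 1" using qr by (simp add: mi)
      then have "0 < s k \<and> s k < 1"
        using bp[of k] by (simp add: si)
      moreover have "0 < s i \<and> s i < 1" if "0 < p i \<and> p i < 1" for i
        using that bm[of i] by (simp add: si)
      ultimately have "\<forall>i<Suc k. i < n \<longrightarrow> i \<notin> A \<longrightarrow> i \<notin> B \<longrightarrow> 0 < s i \<and> s i < 1"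
        using p(2) by (auto simp: less_Suc_eq)
      then show ?thesis using sF by blast
    qed
  qed
  from this[of n] obtain p where p: "p \<in> F"
    "\<And>i. i < n \<Longrightarrow> i \<notin> A \<Longrightarrow> i \<notin> B \<Longrightarrow> 0 < p i \<and> p i < 1" by blast
  have "g \<in> F" if g: "g \<in> subcube n A B" for g
  proof (cases "g = p")
    case False
    \<comment> \<open>\<open>p\<close> is a relative interior point of the subcube, so the segment from \<open>g\<close> to \<open>p\<close> can be
      prolonged beyond \<open>p\<close> within the cube.\<close>
    define q where "q = (\<lambda>t. \<lambda>i. p i + t * (p i - g i))"
    have gC: "g \<in> unit_cube n" using g by (auto simp: subcube_def)
    have "\<forall>\<^sub>F t in at_right 0. 0 \<le> q t i \<and> q t i \<le> 1" if "i < n" for i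
    \<comment> \<open>On \<open>A\<close> and \<open>B\<close> the points \<open>g\<close> and
      \<open>p\<close> agree, so \<open>q t i\<close> does not depend on \<open>t\<close>. Elsewhere
      \<open>p i\<close> is strictly between 0 and 1, and continuity at \<open>t = 0\<close> gives
      the bounds.\<close>
    proof (cases "i \<in> A \<or> i \<in> B")
      case True
      then have "q t i = p i" for t
        using g p(1) by (auto simp: q_def subcube_def A_def B_def)
      then show ?thesis using bounds FC p(1) by (simp add: subset_iff)
    next
      case False
      have "((\<lambda>t. q t i) \<longlongrightarrow> p i + 0 * (p i - g i)) (at_right 0)"
        unfolding q_def by (intro tendsto_intros)
      then have "((\<lambda>t. q t i) \<longlongrightarrow> p i) (at_right 0)" by simp
      with p(2)[OF that] False have "\<forall>\<^sub>F t in at_right 0. 0 < q t i" "\<forall>\<^sub>F t in at_right 0. q t i < 1"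
        by (auto dest: order_tendstoD)
      then show ?thesis by eventually_elim simp
    qed
    then have "\<forall>\<^sub>F t in at_right 0. \<forall>i\<in>{..<n}. 0 \<le> q t i \<and> q t i \<le> 1"
      by (intro eventually_ball_finite) auto
    moreover have "\<forall>\<^sub>F t::real in at_right 0. 0 < t"
      by (simp add: eventually_at_right_less)
    ultimately have "\<forall>\<^sub>F t in at_right 0. 0 < t \<and> (\<forall>i<n. 0 \<le> q t i \<and> q t i \<le> 1)"
      by eventually_elim auto
    then obtain t where t: "0 < t" "\<forall>i<n. 0 \<le> q t i \<and> q t i \<le> 1"
      using eventually_happens trivial_limit_at_right_real by blast
    have qC: "q t \<in> unit_cube n"
      using t gC p(1) FC by (auto simp: unit_cube_def q_def)
    \<comment> \<open>Solving \<open>q t = p + t * (p - g)\<close> for \<open>p\<close> gives the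
      weights \<open>t / (1 + t)\<close> at \<open>g\<close> and \<open>1 / (1 + t)\<close> at
      \<open>q t\<close>.\<close>
    define u where "u = 1 / (1 + t)"
    have u: "0 < u" "u < 1" using t by (auto simp: u_def)
    have "p = (1 - u) *\<^sub>R g + u *\<^sub>R q t"
    proof
      fix i
      have "u * (1 + t) = 1" using t by (simp add: u_def)
      then have "p i = u * (1 + t) * p i + (1 - u * (1 + t)) * g i" by simp
      also have "\<dots> = ((1 - u) *\<^sub>R g + u *\<^sub>R q t) i"
        by (simp add: scaleR_fun_def q_def algebra_simps)
      finally show "p i = ((1 - u) *\<^sub>R g + u *\<^sub>R q t) i" .
    qed
    moreover have "g \<noteq> q t"
    proof
      assume "g = q t"
      then have "(1 + t) * (p i - g i) = 0" for i
        using fun_cong[of g "q t" i] unfolding q_def by (simp add: ring_distribs)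
      then show False using t False by (auto simp: fun_eq_iff)
    qed
    ultimately have "p \<in> open_segment g (q t)"
      using u by (auto simp: in_segment)
    then show ?thesis using F gC qC p(1) unfolding face_of_def by blast
  qed (use p in simp)
  moreover have "F \<subseteq> subcube n A B"
    using FC by (auto simp: subcube_def A_def B_def)
  ultimately have "F = subcube n A B" by blast
  moreover have "A \<inter> B = {}"
  proof -
    have "p i = 0 \<and> p i = 1" if "i \<in> A" "i \<in> B" for i
      using that p(1) unfolding A_def B_def by blast
    then show ?thesis by (metis disjoint_iff zero_neq_one)
  qed
  ultimately show ?thesis
    by (intro that[of A B]) (auto simp: A_def B_def)
qed

text \<open>This replaces faces by pairs of disjoint index sets, the form in which sets of coatoms
  will appear.\<close>

lemma bij_betw_subcube:
  "bij_betw (\<lambda>(A, B). subcube n A B) {(A, B). A \<subseteq> {..<n} \<and> B \<subseteq> {..<n} \<and> A \<inter> B = {}}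
    (nonempty_faces (unit_cube n))"
  unfolding bij_betw_def
proof
  show "inj_on (\<lambda>(A, B). subcube n A B) {(A, B). A \<subseteq> {..<n} \<and> B \<subseteq> {..<n} \<and> A \<inter> B = {}}"
  proof (rule inj_onI, clarify)
    fix A B A' B'
    assume "A \<subseteq> {..<n}" "B \<subseteq> {..<n}" "A \<inter> B = {}" "A' \<subseteq> {..<n}" "B' \<subseteq> {..<n}" "A' \<inter> B' = {}"
      and "subcube n A B = subcube n A' B'"
    then show "A = A' \<and> B = B'"
      using subcube_subset_iff[of A n B A' B'] subcube_subset_iff[of A' n B' A B] by auto
  qed
  show "(\<lambda>(A, B). subcube n A B) ` {(A, B). A \<subseteq> {..<n} \<and> B \<subseteq> {..<n} \<and> A \<inter> B = {}}
    = nonempty_faces (unit_cube n)"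
  proof (intro equalityI subsetI)
    fix F assume "F \<in> nonempty_faces (unit_cube n)"
    then have "F face_of unit_cube n" "F \<noteq> {}"
      by (auto simp: nonempty_faces_def)
    then obtain A B where "A \<subseteq> {..<n}" "B \<subseteq> {..<n}" "A \<inter> B = {}" "F = subcube n A B"
      by (rule face_of_unit_cube_eq_subcube)
    then show "F \<in> (\<lambda>(A, B). subcube n A B) ` {(A, B). A \<subseteq> {..<n} \<and> B \<subseteq> {..<n} \<and> A \<inter> B = {}}"
      by (intro image_eqI[of _ _ "(A, B)"]) auto
  next
    fix F assume "F \<in> (\<lambda>(A, B). subcube n A B) ` {(A, B). A \<subseteq> {..<n} \<and> B \<subseteq> {..<n} \<and> A \<inter> B = {}}"
    then obtain A B where "B \<subseteq> {..<n}" "A \<inter> B = {}" "F = subcube n A B"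
      by auto
    then show "F \<in> nonempty_faces (unit_cube n)"
      using subcube_face_of[of n A B] center_in_subcube[of B n A] by (auto simp: nonempty_faces_def)
  qed
qed

section \<open>Coatoms of a finite MR-algebra\<close>

definition coatoms_above :: "'a::order_top \<Rightarrow> 'a set"
  where "coatoms_above x = {c. x \<le> c \<and> c < top \<and> (\<forall>d. c < d \<longrightarrow> d = top)}"

text \<open>Accordingly \<open>c \<in> coatoms_above c\<close> says that \<open>c\<close> is a coatom.\<close>

lemma coatoms_above_top: "coatoms_above top = {}"
  by (auto simp: coatoms_above_def)

lemma coatoms_above_antimono: "x \<le> y \<Longrightarrow> coatoms_above y \<subseteq> coatoms_above x"
  by (auto simp: coatoms_above_def)

lemma coatoms_above_coatom:
  assumes "c \<in> coatoms_above x"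
  shows "coatoms_above c = {c}"
proof -
  have c: "c < top" "\<And>d. c < d \<Longrightarrow> d = top"
    using assms by (auto simp: coatoms_above_def)
  have "d = c" if "c \<le> d" "d < top" for d
    using c(2)[of d] that by (metis le_neq_trans order_less_irrefl)
  with c show ?thesis by (auto simp: coatoms_above_def)
qed

lemma in_coatoms_above_iff: "c \<in> coatoms_above x \<longleftrightarrow> x \<le> c \<and> c \<in> coatoms_above c"
  by (auto simp: coatoms_above_def)

lemma sup_coatom_eq_top:
  fixes c :: "'a::{semilattice_sup, order_top}"
  assumes "c \<in> coatoms_above c" "\<not> x \<le> c"
  shows "sup c x = top"
proof -
  have "c < sup c x"
    using assms(2) by (metis le_iff_sup less_le sup.cobounded1 sup.commute)
  then show ?thesis using assms(1) by (simp add: coatoms_above_def)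
qed

lemma coatoms_above_nonempty:
  fixes x :: "'a::{finite, order_top}"
  assumes "x \<noteq> top"
  obtains c where "c \<in> coatoms_above x"
proof -
  have "{y. x \<le> y \<and> y < top} \<noteq> {}"
    using assms by (auto simp: top.not_eq_extremum)
  then obtain c where c: "x \<le> c" "c < top" "\<And>d. x \<le> d \<Longrightarrow> d < top \<Longrightarrow> c \<le> d \<Longrightarrow> c = d"
    using finite_has_maximal[of "{y. x \<le> y \<and> y < top}"] by auto
  have "d = top" if "c < d" for d
  proof (rule ccontr)
    assume "d \<noteq> top"
    then have "d < top" by (simp add: top.not_eq_extremum)
    moreover have "x \<le> d" using c(1) that by order
    ultimately show False using c(3)[of d] that by (simp add: less_le)
  qed
  with c(1,2) have "c \<in> coatoms_above x"
    by (simp add: coatoms_above_def)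
  then show ?thesis by (rule that)
qed

text \<open>By finiteness there is a maximal common lower bound. Its join with any other common
  lower bound is again one, so it is the greatest.\<close>

lemma isGlb_if_lower_bound:
  fixes a b z :: "'a::{finite, semilattice_sup}"
  assumes "z \<le> a" "z \<le> b"
  shows "\<exists>m. isGlb UNIV {a, b} m"
proof -
  have "{y. y \<le> a \<and> y \<le> b} \<noteq> {}" using assms by blast
  then obtain m where m: "m \<le> a" "m \<le> b" "\<And>y. y \<le> a \<Longrightarrow> y \<le> b \<Longrightarrow> m \<le> y \<Longrightarrow> m = y"
    using finite_has_maximal[of "{y. y \<le> a \<and> y \<le> b}"] by auto
  then have "y \<le> m" if "y \<le> a" "y \<le> b" for y
    using that by (metis le_sup_iff sup.cobounded1 sup.cobounded2)
  with m have "isGlb UNIV {a, b} m"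
    by (auto simp: isGlb_def isLb_def greatestP_def setle_def setge_def)
  then show ?thesis by blast
qed

section \<open>Implication and the reflection \<open>\<Delta> top\<close> in a cubic algebra\<close>

context cubic_algebra
begin

abbreviation imp :: "'a \<Rightarrow> 'a \<Rightarrow> 'a" where "imp \<equiv> cubic_imp \<Delta>"

lemma Delta_le: "x \<le> y \<Longrightarrow> \<Delta> y x \<le> y"
  using sup_Delta by (metis sup.cobounded1)

text \<open>Applying the monotone involution \<open>\<Delta> x\<close> to
  \<open>\<Delta> x x \<le> x\<close> gives the reverse inequality.\<close>

lemma Delta_self: "\<Delta> x x = x"
  using Delta_le[of x x] Delta_mono[of "\<Delta> x x" x x] Delta_invol[of x x] by (auto intro: antisym)

lemma Delta_top_le_iff: "\<Delta> top x \<le> \<Delta> top y \<longleftrightarrow> x \<le> y"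
  using Delta_mono[of _ _ top] Delta_invol[of _ top] by (metis top_greatest)

lemma le_imp: "y \<le> imp x y"
  by (simp add: cubic_imp_def)

lemma imp_sup_left: "imp (sup x y) y = imp x y"
  by (simp add: cubic_imp_def)

text \<open>If \<open>imp x y = top\<close>, then
  \<open>sup x y = imp (imp x y) y = imp top y = y\<close>. Conversely, \<open>imp x y\<close>
  reduces to \<open>sup (\<Delta> top y) y\<close>.\<close>

lemma imp_eq_top_iff: "imp x y = top \<longleftrightarrow> x \<le> y"
proof
  have top_imp: "imp top y = y"
    by (simp add: cubic_imp_def Delta_invol sup_absorb1)
  assume "imp x y = top"
  then show "x \<le> y"
    using imp_imp[of x y] top_imp by (simp add: le_iff_sup)
next
  assume "x \<le> y"
  then show "imp x y = top"
    using sup_Delta[of y top] by (simp add: cubic_imp_def sup_absorb2 Delta_self)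
qed

text \<open>With \<open>w = \<Delta> (sup x y) y\<close>, the join of \<open>\<Delta> top w\<close>
  and \<open>w\<close> is \<open>top\<close>, and \<open>w\<close> may be enlarged to
  \<open>sup x y\<close>. Thus \<open>imp x y\<close> acts as a complement of \<open>x\<close> above
  \<open>y\<close>.\<close>

lemma sup_imp_eq_top: "sup x (imp x y) = top"
proof -
  have "\<Delta> (sup x y) y \<le> sup x y" by (simp add: Delta_le)
  moreover have "sup (\<Delta> top (\<Delta> (sup x y) y)) (\<Delta> (sup x y) y) = top"
    by (simp add: sup_Delta)
  ultimately have "top \<le> sup (\<Delta> top (\<Delta> (sup x y) y)) (sup x y)"
    by (metis sup.mono order_refl)
  then show ?thesis
    by (simp add: cubic_imp_def top_unique ac_simps)
qed

text \<open>Write \<open>z\<close> as \<open>imp (imp z y) y\<close>. Left commutation then exhibits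
  \<open>imp x z\<close> as an implication with conclusion \<open>imp x y\<close>.\<close>

lemma imp_mono_right:
  assumes "y \<le> z"
  shows "imp x y \<le> imp x z"
proof -
  have "imp x z = imp x (imp (imp z y) y)"
    using assms by (simp add: imp_imp sup_absorb1)
  also have "\<dots> = imp (imp z y) (imp x y)"
    by (rule imp_left_commute)
  finally show ?thesis by (simp add: le_imp)
qed

lemma imp_eq_right: "sup x y = top \<Longrightarrow> imp x y = y"
  using imp_sup_left[of x y] by (simp add: cubic_imp_def Delta_invol)

text \<open>This is the distributive law \<open>sup d (inf c m) = inf (sup d c) (sup d m)\<close> in the only case
  needed.\<close>

lemma sup_glb_eq_top:
  fixes c m d k :: 'a
  assumes "isGlb UNIV {c, m} k" "sup d c = top" "sup d m = top"
  shows "sup d k = top"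
proof -
  have k: "k \<le> c" "k \<le> m" and glb: "\<And>y. y \<le> c \<Longrightarrow> y \<le> m \<Longrightarrow> y \<le> k"
    using assms(1) by (auto simp: isGlb_def isLb_def greatestP_def setle_def setge_def)
  \<comment> \<open>Monotonicity puts \<open>imp d k\<close> below \<open>imp d c = c\<close> and
    \<open>imp d m = m\<close>, hence below their meet \<open>k\<close>.\<close>
  have "imp d k \<le> c" "imp d k \<le> m"
    using imp_mono_right k imp_eq_right assms(2,3) by metis+
  then have "imp (imp d k) k = top"
    by (simp add: glb imp_eq_top_iff)
  then show ?thesis by (simp add: imp_imp)
qed

text \<open>As a monotone involution, \<open>\<Delta> top\<close> is an order automorphism, so it
  permutes the coatoms.\<close>

lemma Delta_top_coatom:
  assumes "c \<in> coatoms_above c"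
  shows "\<Delta> top c \<in> coatoms_above (\<Delta> top c)"
proof -
  have inv: "\<Delta> top (\<Delta> top d) = d" for d by (simp add: Delta_invol)
  have "\<Delta> top c \<noteq> top"
    using assms inv[of c] Delta_self[of top] by (auto simp: coatoms_above_def)
  moreover have "d = top" if "\<Delta> top c < d" for d
  proof -
    have "c < \<Delta> top d"
      using that Delta_top_le_iff inv by (metis less_le_not_le)
    then have "\<Delta> top d = top" using assms by (auto simp: coatoms_above_def)
    then show ?thesis using inv[of d] Delta_self[of top] by simp
  qed
  ultimately show ?thesis by (simp add: coatoms_above_def top.not_eq_extremum)
qed

lemma Delta_top_neq: "c \<noteq> top \<Longrightarrow> \<Delta> top c \<noteq> c"
  using sup_Delta[of c top] by auto

end

section \<open>Sets of coatoms in a finite MR-algebra\<close>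

locale finite_MR_algebra = MR_algebra \<Delta>
  for \<Delta> :: "'a::{finite, semilattice_sup, order_top} \<Rightarrow> 'a \<Rightarrow> 'a"
begin

text \<open>If \<open>x \<le> y\<close> fails, some coatom lies above \<open>imp x y\<close>, hence
  above \<open>y\<close>. It cannot lie above \<open>x\<close> as well, because \<open>x\<close> and
  \<open>imp x y\<close> have join \<open>top\<close>.\<close>

lemma coatoms_above_subset_iff:
  fixes x y :: 'a
  shows "coatoms_above y \<subseteq> coatoms_above x \<longleftrightarrow> x \<le> y"
proof
  assume sub: "coatoms_above y \<subseteq> coatoms_above x"
  show "x \<le> y"
  proof (rule ccontr)
    assume "\<not> x \<le> y"
    then obtain d where d: "d \<in> coatoms_above (imp x y)"
      using coatoms_above_nonempty imp_eq_top_iff by metis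
    with sub have "d \<in> coatoms_above x"
      using coatoms_above_antimono[OF le_imp] by blast
    with d have "sup x (imp x y) \<le> d" "d < top"
      by (auto simp: coatoms_above_def)
    then show False by (simp add: sup_imp_eq_top top_unique)
  qed
qed (rule coatoms_above_antimono)

text \<open>The MR-axiom at \<open>top\<close> denies a meet to \<open>c\<close> and
  \<open>\<Delta> top c\<close>, since \<open>sup c c = c < top\<close>; but a common lower bound
  \<open>x\<close> would provide one.\<close>

lemma coatoms_above_no_opposite:
  assumes "c \<in> coatoms_above x"
  shows "\<Delta> top c \<notin> coatoms_above x"
proof
  assume "\<Delta> top c \<in> coatoms_above x"
  with assms have *: "x \<le> c" "x \<le> \<Delta> top c" "c < top" "\<Delta> top c < top"
    by (auto simp: coatoms_above_def)
  moreover have "sup (\<Delta> top (\<Delta> top c)) c < top"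
    using * by (simp add: Delta_invol)
  ultimately show False
    using MR[of "\<Delta> top c" top c] isGlb_if_lower_bound[of x "\<Delta> top c" c] by blast
qed

text \<open>The element is built by adding one coatom at a time: the MR-axiom supplies the meet with
  the new coatom, and distributivity shows that no other coatom appears above this meet.\<close>

lemma ex_coatoms_above_eq:
  assumes "\<And>c. c \<in> T \<Longrightarrow> c \<in> coatoms_above c" "\<And>c. c \<in> T \<Longrightarrow> \<Delta> top c \<notin> T"
  shows "\<exists>x. coatoms_above x = T"
proof -
  have "finite T" by simp
  then show ?thesis using assms
  proof (induction T rule: finite_induct)
    case empty
    then show ?case using coatoms_above_top by blast
  next
    case (insert c T)
    have c: "c \<in> coatoms_above c" using insert by blast
    obtain m where m: "coatoms_above m = T" using insert by blast
    show ?case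
    \<comment> \<open>The MR-axiom speaks only of elements strictly below \<open>top\<close>, so
      \<open>m = top\<close> is treated apart.\<close>
    proof (cases "m = top")
      case True
      then have "T = {}" using m coatoms_above_top by auto
      then show ?thesis using coatoms_above_coatom[OF c] by auto
    next
      case False
      have "\<Delta> top c \<notin> T" using insert.prems(2)[of c] by blast
      then have "\<not> m \<le> \<Delta> top c"
        using m Delta_top_coatom[OF c] in_coatoms_above_iff by blast
      then have "sup (\<Delta> top c) m = top"
        using sup_coatom_eq_top[OF Delta_top_coatom[OF c]] by blast
      moreover have "c < top" using c by (simp add: coatoms_above_def)
      ultimately obtain k where k: "isGlb UNIV {c, m} k"
        using MR[of c top m] False by (auto simp: top.not_eq_extremum)
      then have kle: "k \<le> c" "k \<le> m"
        by (auto simp: isGlb_def isLb_def greatestP_def setle_def setge_def)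
      have "d \<in> insert c T" if d: "d \<in> coatoms_above k" for d
      proof (rule ccontr)
        assume nd: "d \<notin> insert c T"
        have dd: "d \<in> coatoms_above d" using d in_coatoms_above_iff by blast
        have "\<not> m \<le> d" using nd m dd in_coatoms_above_iff by blast
        moreover have "\<not> c \<le> d"
          using nd coatoms_above_coatom[OF c] dd in_coatoms_above_iff by blast
        \<comment> \<open>A coatom \<open>d\<close> that is above neither \<open>c\<close> nor
          \<open>m\<close> has join \<open>top\<close> with both, hence with their meet
          \<open>k\<close>, although \<open>k \<le> d\<close>.\<close>
        ultimately have "sup d k = top"
          using sup_glb_eq_top[OF k] sup_coatom_eq_top[OF dd] by blast
        with d show False
          by (auto simp: coatoms_above_def sup_absorb1)
      qed
      moreover have "insert c T \<subseteq> coatoms_above k"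
        using m c kle coatoms_above_antimono by blast
      ultimately show ?thesis by blast
    qed
  qed
qed

text \<open>The enumeration picks one coatom from each pair of opposite ones, so \<open>n\<close> is
  the number of pairs and will be the dimension of the cube.\<close>

lemma coatom_enumeration:
  obtains e :: "nat \<Rightarrow> 'a" and n where "inj_on e {..<n}"
    "\<And>c. c \<in> coatoms_above c \<longleftrightarrow> c \<in> e ` {..<n} \<or> \<Delta> top c \<in> e ` {..<n}"
    "\<And>c. c \<in> e ` {..<n} \<Longrightarrow> \<Delta> top c \<notin> e ` {..<n}"
proof -
  obtain h :: "'a \<Rightarrow> nat" where h: "inj h"
    using finite_imp_inj_to_nat_seg[of "UNIV :: 'a set"] by auto
  \<comment> \<open>An injection into the naturals breaks the symmetry: the representative of a pair
    is the coatom with the smaller code. The codes differ because \<open>\<Delta> top\<close> fixes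
    no coatom.\<close>
  define P where "P = {c. c \<in> coatoms_above c \<and> h c < h (\<Delta> top c)}"
  obtain e where e: "bij_betw e {0..<card P} P"
    using ex_bij_betw_nat_finite[of P] by auto
  have inv: "\<Delta> top (\<Delta> top d) = d" for d by (simp add: Delta_invol)
  have "c \<in> coatoms_above c \<longleftrightarrow> c \<in> P \<or> \<Delta> top c \<in> P" for c
  proof
    assume c: "c \<in> coatoms_above c"
    then have "c \<noteq> top" by (auto simp: coatoms_above_def)
    then have "h c \<noteq> h (\<Delta> top c)"
      using Delta_top_neq[of c] injD[OF h, of c "\<Delta> top c"] by auto
    then show "c \<in> P \<or> \<Delta> top c \<in> P"
      using c Delta_top_coatom[OF c] inv[of c] by (auto simp: P_def)
  next
    assume "c \<in> P \<or> \<Delta> top c \<in> P"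
    then show "c \<in> coatoms_above c"
      using Delta_top_coatom[of "\<Delta> top c"] inv[of c] by (auto simp: P_def)
  qed
  moreover have "\<Delta> top c \<notin> P" if "c \<in> P" for c
    using that inv[of c] by (auto simp: P_def)
  moreover have "e ` {..<card P} = P" "inj_on e {..<card P}"
    using e by (auto simp: bij_betw_def atLeast0LessThan)
  ultimately show ?thesis using that[of e "card P"] by simp
qed

end

section \<open>The order isomorphism with the faces of the cube\<close>

theorem mainTheorem7:
  fixes \<Delta> :: "'a::{finite, semilattice_sup, order_top} \<Rightarrow> 'a \<Rightarrow> 'a"
  assumes "MR_algebra \<Delta>"
  shows "\<exists>(n::nat) (f :: 'a \<Rightarrow> (nat \<Rightarrow> real) set).
    bij_betw f UNIV (nonempty_faces (unit_cube n)) \<and>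
    (\<forall>x y. x \<le> y \<longleftrightarrow> f x \<subseteq> f y)"
proof -
  interpret finite_MR_algebra \<Delta>
    using assms by (simp add: finite_MR_algebra_def)
  obtain e :: "nat \<Rightarrow> 'a" and n where e: "inj_on e {..<n}"
    "\<And>c. c \<in> coatoms_above c \<longleftrightarrow> c \<in> e ` {..<n} \<or> \<Delta> top c \<in> e ` {..<n}"
    "\<And>c. c \<in> e ` {..<n} \<Longrightarrow> \<Delta> top c \<notin> e ` {..<n}"
    using coatom_enumeration by blast
  have inv: "\<Delta> top (\<Delta> top d) = d" for d by (simp add: Delta_invol)
  \<comment> \<open>The coatom \<open>e i\<close> plays the facet \<open>p i = 0\<close>, and its
    opposite plays the facet \<open>p i = 1\<close>.\<close>
  define A where "A = (\<lambda>x. {i. i < n \<and> e i \<in> coatoms_above x})"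
  define B where "B = (\<lambda>x. {i. i < n \<and> \<Delta> top (e i) \<in> coatoms_above x})"
  have coatoms: "coatoms_above x = e ` A x \<union> (\<lambda>i. \<Delta> top (e i)) ` B x" for x
  proof (intro equalityI subsetI)
    fix c assume c: "c \<in> coatoms_above x"
    then consider i where "i < n" "c = e i" | i where "i < n" "\<Delta> top c = e i"
      using e(2)[of c] in_coatoms_above_iff[of c x] by blast
    then show "c \<in> e ` A x \<union> (\<lambda>i. \<Delta> top (e i)) ` B x"
    proof cases
      case 1
      then show ?thesis using c by (auto simp: A_def)
    next
      case (2 i)
      then have "c = \<Delta> top (e i)" using inv[of c] by simp
      then show ?thesis using c 2 by (auto simp: B_def)
    qed
  qed (auto simp: A_def B_def)
  have AB: "A x \<subseteq> {..<n}" "B x \<subseteq> {..<n}" "A x \<inter> B x = {}" for x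
    using coatoms_above_no_opposite by (auto simp: A_def B_def)
  have le_iff: "x \<le> y \<longleftrightarrow> A y \<subseteq> A x \<and> B y \<subseteq> B x" for x y
  proof
    assume "x \<le> y"
    then show "A y \<subseteq> A x \<and> B y \<subseteq> B x"
      using coatoms_above_antimono by (auto simp: A_def B_def)
  next
    assume "A y \<subseteq> A x \<and> B y \<subseteq> B x"
    then show "x \<le> y"
      unfolding coatoms_above_subset_iff[symmetric] coatoms by blast
  qed
  have surj: "\<exists>x. A x = A' \<and> B x = B'" if "A' \<subseteq> {..<n}" "B' \<subseteq> {..<n}" "A' \<inter> B' = {}" for A' B'
  proof -
    have e_Delta: "e i \<noteq> \<Delta> top (e j)" if "i < n" "j < n" for i j
      using e(3)[of "e j"] that by (metis imageI lessThan_iff)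
    have e_inj: "e i = e j \<longleftrightarrow> i = j" if "i < n" "j < n" for i j
      using e(1) that by (auto simp: inj_on_def)
    have Delta_inj: "\<Delta> top c = \<Delta> top d \<longleftrightarrow> c = d" for c d
      using inv by metis
    \<comment> \<open>These are the coatoms prescribed by \<open>A'\<close> and \<open>B'\<close>.
      Disjointness of \<open>A'\<close> and \<open>B'\<close> means that \<open>T\<close> contains
      no opposite pair, so it is the set of coatoms above some element.\<close>
    define T where "T = e ` A' \<union> (\<lambda>i. \<Delta> top (e i)) ` B'"
    have "c \<in> coatoms_above c" if "c \<in> T" for c
      using that \<open>A' \<subseteq> {..<n}\<close> \<open>B' \<subseteq> {..<n}\<close> inv unfolding e(2)[of c] T_def by auto
    moreover have e_T: "e i \<in> T \<longleftrightarrow> i \<in> A'" "\<Delta> top (e i) \<in> T \<longleftrightarrow> i \<in> B'" if "i < n" for i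
      using that \<open>A' \<subseteq> {..<n}\<close> \<open>B' \<subseteq> {..<n}\<close> e_inj e_Delta e_Delta[symmetric]
      by (auto simp: T_def Delta_inj)
    moreover have "\<Delta> top c \<notin> T" if c: "c \<in> T" for c
    proof -
      consider i where "i \<in> A'" "c = e i" | i where "i \<in> B'" "c = \<Delta> top (e i)"
        using c by (auto simp: T_def)
      then show ?thesis
      proof cases
        case (1 i)
        then have "i < n" "i \<notin> B'"
          using \<open>A' \<subseteq> {..<n}\<close> \<open>A' \<inter> B' = {}\<close> by auto
        then show ?thesis using e_T 1 by simp
      next
        case (2 i)
        then have "i < n" "i \<notin> A'"
          using \<open>B' \<subseteq> {..<n}\<close> \<open>A' \<inter> B' = {}\<close> by auto
        then show ?thesis using e_T 2 inv by simp
      qed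
    qed
    ultimately obtain x where "coatoms_above x = T"
      using ex_coatoms_above_eq by blast
    then have "A x = A' \<and> B x = B'"
      using e_T \<open>A' \<subseteq> {..<n}\<close> \<open>B' \<subseteq> {..<n}\<close> by (auto simp: A_def B_def)
    then show ?thesis by blast
  qed
  have "bij_betw (\<lambda>x. (A x, B x)) UNIV {(A, B). A \<subseteq> {..<n} \<and> B \<subseteq> {..<n} \<and> A \<inter> B = {}}"
    unfolding bij_betw_def
  proof
    show "inj (\<lambda>x. (A x, B x))"
      by (rule injI) (auto intro: antisym simp: le_iff)
    show "range (\<lambda>x. (A x, B x)) = {(A, B). A \<subseteq> {..<n} \<and> B \<subseteq> {..<n} \<and> A \<inter> B = {}}"
    proof (intro equalityI subsetI)
      fix P assume "P \<in> {(A, B). A \<subseteq> {..<n} \<and> B \<subseteq> {..<n} \<and> A \<inter> B = {}}"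
      then obtain A' B' where "P = (A', B')" "A' \<subseteq> {..<n}" "B' \<subseteq> {..<n}" "A' \<inter> B' = {}"
        by blast
      then show "P \<in> range (\<lambda>x. (A x, B x))"
        using surj[of A' B'] by auto
    qed (use AB in \<open>auto simp: disjoint_iff\<close>)
  qed
  from bij_betw_trans[OF this bij_betw_subcube]
  have "bij_betw (\<lambda>x. subcube n (A x) (B x)) UNIV (nonempty_faces (unit_cube n))"
    by (simp add: o_def)
  \<comment> \<open>Both orders are reverse inclusion of the index sets in each component.\<close>
  moreover have "x \<le> y \<longleftrightarrow> subcube n (A x) (B x) \<subseteq> subcube n (A y) (B y)" for x y
    using subcube_subset_iff[of "A x" n "B x" "A y" "B y"] AB le_iff by simp
  ultimately show ?thesis by blast
qed

end
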